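(* Fix $\varepsilon\in(0,1)$. If $\mathcal A$ is an $\varepsilon$-edge differentially private mechanism that answers maximum matching size queries on graphs with $n$ vertices in the continual release model for fully dynamic streams of length $T$, such that with probability at least $0.99$ its outputs are within additive error $\zeta$, then $$\zeta=\Omega\!\left(\min\left(\sqrt{\frac n\varepsilon},\ \frac{T^{1/4}}{\varepsilon^{3/4}},\ n,\ T\right)\right).$$ Moreover, this holds even if accuracy is only required on streams in which every intermediate graph is bipartite, has maximum degree $2$, and has arboricity $1$.
   Context: A fully dynamic stream of length $T$ on a fixed vertex set of size $n$ is a sequence of updates, each an edge insertion, an edge deletion, or the empty update $\bot$. Two streams are edge-neighboring if they differ in exactly one timestep $t^*$, where one has $\bot$ and the other an edge insertion or deletion. A mechanism is $\varepsilon$-edge DP if for all edge-neighboring streams $S,S'$ and all output sets $Y$, $\Pr[\mathcal A(S)\in Y]\le e^\varepsilon\Pr[\mathcal A(S')\in Y]$. The continual release mechanism outputs an estimate after every update. Arboricity is the minimum number of forests partitioning the edge set. *)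

theory Defs
  imports "HOL-Probability.Probability" "HOL-Library.Disjoint_Sets"
begin

text \<open>Finite simple graphs on the vertex set \<open>{..<n}\<close>, given by their edge set; an edge is
  the unordered pair of its end points.\<close>

type_synonym edge = "nat set"

definition all_edges :: "nat \<Rightarrow> edge set" where
  "all_edges n = {{u, v} | u v. u < n \<and> v < n \<and> u \<noteq> v}"

definition is_matching :: "edge set \<Rightarrow> edge set \<Rightarrow> bool" where
  "is_matching E M \<longleftrightarrow> M \<subseteq> E \<and> disjoint M"

definition max_matching_size :: "edge set \<Rightarrow> nat" where
  "max_matching_size E = Max (card ` {M. is_matching E M})"

definition bipartite :: "edge set \<Rightarrow> bool" where
  "bipartite E \<longleftrightarrow> (\<exists>X Y. X \<inter> Y = {} \<and> (\<forall>e\<in>E. \<exists>u\<in>X. \<exists>v\<in>Y. e = {u, v}))"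

definition degree :: "edge set \<Rightarrow> nat \<Rightarrow> nat" where
  "degree E v = card {e \<in> E. v \<in> e}"

definition max_degree :: "nat \<Rightarrow> edge set \<Rightarrow> nat" where
  "max_degree n E = Max (degree E ` {..<n})"

definition is_cycle :: "edge set \<Rightarrow> nat list \<Rightarrow> bool" where
  "is_cycle E vs \<longleftrightarrow> 3 \<le> length vs \<and> distinct vs \<and>
     (\<forall>i < length vs. {vs ! i, vs ! (Suc i mod length vs)} \<in> E)"

definition forest :: "edge set \<Rightarrow> bool" where
  "forest E \<longleftrightarrow> (\<nexists>vs. is_cycle E vs)"

definition arboricity :: "edge set \<Rightarrow> nat" where
  "arboricity E =
     (LEAST k. \<exists>P. partition_on E P \<and> finite P \<and> card P = k \<and> (\<forall>F\<in>P. forest F))"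

datatype update = Ins edge | Del edge | Noop

definition updates :: "nat \<Rightarrow> update set" where
  "updates n = Ins ` all_edges n \<union> Del ` all_edges n \<union> {Noop}"

definition streams_of :: "nat \<Rightarrow> nat \<Rightarrow> update list set" where
  "streams_of n T = {S. length S = T \<and> set S \<subseteq> updates n}"

text \<open>Inserting a present edge or deleting an absent one leaves the graph unchanged.\<close>

fun apply_update :: "update \<Rightarrow> edge set \<Rightarrow> edge set" where
  "apply_update (Ins e) E = insert e E"
| "apply_update (Del e) E = E - {e}"
| "apply_update Noop E = E"

definition graph_at :: "update list \<Rightarrow> nat \<Rightarrow> edge set" where
  "graph_at S t = fold apply_update (take t S) {}"

definition edge_neighboring :: "update list \<Rightarrow> update list \<Rightarrow> bool" where
  "edge_neighboring S S' \<longleftrightarrow> length S = length S' \<and>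
     (\<exists>t < length S. S ! t \<noteq> S' ! t \<and> (S ! t = Noop \<or> S' ! t = Noop) \<and>
        (\<forall>i < length S. i \<noteq> t \<longrightarrow> S ! i = S' ! i))"

text \<open>A mechanism maps a stream of length \<open>T\<close> to the joint law of its \<open>T\<close> real outputs;
  coordinate \<open>t\<close> is the estimate released after the first \<open>Suc t\<close> updates.\<close>

type_synonym mechanism = "update list \<Rightarrow> (nat \<Rightarrow> real) measure"

abbreviation output_space :: "nat \<Rightarrow> (nat \<Rightarrow> real) measure" where
  "output_space T \<equiv> Pi\<^sub>M {..<T} (\<lambda>_. borel)"

text \<open>The last clause says that the mechanism is online: the law of the first \<open>t\<close> outputs is
  determined by the first \<open>t\<close> updates.\<close>

definition continual_release :: "nat \<Rightarrow> nat \<Rightarrow> mechanism \<Rightarrow> bool" where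
  "continual_release n T A \<longleftrightarrow>
     (\<forall>S \<in> streams_of n T. prob_space (A S) \<and> sets (A S) = sets (output_space T)) \<and>
     (\<forall>S \<in> streams_of n T. \<forall>S' \<in> streams_of n T. \<forall>t \<le> T. take t S = take t S' \<longrightarrow>
        distr (A S) (output_space t) (\<lambda>w. restrict w {..<t}) =
        distr (A S') (output_space t) (\<lambda>w. restrict w {..<t}))"

definition edge_DP :: "nat \<Rightarrow> nat \<Rightarrow> real \<Rightarrow> mechanism \<Rightarrow> bool" where
  "edge_DP n T \<epsilon> A \<longleftrightarrow>
     (\<forall>S \<in> streams_of n T. \<forall>S' \<in> streams_of n T. edge_neighboring S S' \<longrightarrow>
        (\<forall>Y \<in> sets (output_space T). measure (A S) Y \<le> exp \<epsilon> * measure (A S') Y))"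

definition matching_accurate_on :: "update list set \<Rightarrow> nat \<Rightarrow> real \<Rightarrow> mechanism \<Rightarrow> bool" where
  "matching_accurate_on \<S> T \<zeta> A \<longleftrightarrow>
     (\<forall>S \<in> \<S>. measure (A S) {w \<in> space (A S).
        \<forall>t < T. \<bar>w t - real (max_matching_size (graph_at S (Suc t)))\<bar> \<le> \<zeta>} \<ge> 99 / 100)"

text \<open>Degree and arboricity are upper bounds: the first graph of any stream has at most one edge,
  so no stream has maximum degree exactly 2 throughout.\<close>

definition restricted_streams :: "nat \<Rightarrow> nat \<Rightarrow> update list set" where
  "restricted_streams n T = {S \<in> streams_of n T. \<forall>t \<le> T.
     bipartite (graph_at S t) \<and> max_degree n (graph_at S t) \<le> 2 \<and> arboricity (graph_at S t) \<le> 1}"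

definition error_bound :: "nat \<Rightarrow> nat \<Rightarrow> real \<Rightarrow> real" where
  "error_bound n T \<epsilon> =
     min (sqrt (real n / \<epsilon>))
       (min (real T powr (1 / 4) / \<epsilon> powr (3 / 4)) (min (real n) (real T)))"

end

theory Submission
  imports Defs
begin

text \<open>
  Gadget \<open>j\<close> is a path with two edges: a data edge, present iff \<open>j\<close> belongs to a secret set, and a
  query edge sharing its centre, present iff \<open>j\<close> belongs to a query set. The maximum matching has
  one edge for each gadget that is not empty, so it counts the union of the two sets. Only the
  insertion of the data edges depends on the secret; afterwards many queries are asked by toggling
  query edges.

  Take \<open>m\<close> secret bits with \<open>m\<close> a power of two, and copy each into \<open>B = \<lfloor>1/\<epsilon>\<rfloor>\<close> gadgets, so that
  flipping a bit changes every output probability by a factor of at most \<open>e\<close>. Querying the rows of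
  an \<open>m \<times> m\<close> Hadamard matrix and inverting the transform recovers the bits with total squared error
  \<open>O((\<zeta>/B)\<^sup>2)\<close>. If \<open>\<zeta>\<close> were below a small multiple of \<open>B \<surd>m\<close>, rounding would give almost all bits
  correctly, which averaging over secrets and bits shows to be impossible under privacy. The attack
  needs \<open>3 m B\<close> vertices and \<open>m (m + 1) B\<close> updates; the largest admissible \<open>m\<close> gives the first two
  terms of the minimum. If not even \<open>m = 1\<close> is admissible, comparing the empty stream with the
  insertion of a matching of size about \<open>min(1/\<epsilon>, n/2, T)\<close> gives the last two terms.
\<close>

section \<open>The gadget graph\<close>

text \<open>The centre of gadget \<open>j\<close> is \<open>2 * j + 1\<close>. The query leaves are
  numbered after all the data vertices, so data edges alone fit on \<open>2 * N\<close> vertices;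
  the two-point argument relies on this.\<close>

definition data_edge :: "nat \<Rightarrow> edge" where
  "data_edge j = {2 * j, 2 * j + 1}"

definition query_edge :: "nat \<Rightarrow> nat \<Rightarrow> edge" where
  "query_edge N j = {2 * j + 1, 2 * N + j}"

definition gadget_graph :: "nat \<Rightarrow> nat set \<Rightarrow> nat set \<Rightarrow> edge set" where
  "gadget_graph N X Q = data_edge ` X \<union> query_edge N ` Q"

lemma data_edge_eq_iff: "data_edge i = data_edge j \<longleftrightarrow> i = j"
  by (auto simp: data_edge_def doubleton_eq_iff)

lemma query_edge_eq_iff: "query_edge N i = query_edge N j \<longleftrightarrow> i = j"
  by (auto simp: query_edge_def doubleton_eq_iff)

lemma data_edge_neq_query_edge: "i < N \<Longrightarrow> data_edge i \<noteq> query_edge N j"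
  by (auto simp: data_edge_def query_edge_def doubleton_eq_iff)

lemma gadget_graph_mono:
  "X \<subseteq> X' \<Longrightarrow> Q \<subseteq> Q' \<Longrightarrow> gadget_graph N X Q \<subseteq> gadget_graph N X' Q'"
  by (auto simp: gadget_graph_def)

lemma gadget_edge_cases:
  assumes "e \<in> gadget_graph N X Q"
  obtains (data) i where "i \<in> X" "e = data_edge i"
    | (query) i where "i \<in> Q" "e = query_edge N i"
  using assms by (auto simp: gadget_graph_def)

lemma max_matching_size_eqI:
  assumes "finite E" "is_matching E M" "card M = k"
    and "\<And>M'. is_matching E M' \<Longrightarrow> card M' \<le> k"
  shows "max_matching_size E = k"
proof -
  have "{M. is_matching E M} \<subseteq> Pow E"
    by (auto simp: is_matching_def)
  then have "finite {M. is_matching E M}"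
    using assms(1) by (meson finite_Pow_iff finite_subset)
  then show ?thesis
    unfolding max_matching_size_def using assms by (intro Max_eqI) auto
qed

text \<open>Gadgets below \<open>N\<close> are vertex disjoint, so two edges can only meet inside
  one gadget, and \<open>X \<inter> Q = {}\<close> leaves each gadget at most one edge.\<close>

lemma disjoint_gadget_matching:
  assumes "X \<subseteq> {..<N}" "Q \<subseteq> {..<N}" "X \<inter> Q = {}"
  shows "disjoint (gadget_graph N X Q)"
proof (rule disjointI)
  fix a b assume "a \<in> gadget_graph N X Q" "b \<in> gadget_graph N X Q" "a \<noteq> b"
  then show "a \<inter> b = {}"
  proof (elim gadget_edge_cases; clarify)
    fix i j assume "i \<in> X" "j \<in> X" "data_edge i \<noteq> data_edge j"
    then show "data_edge i \<inter> data_edge j = {}"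
      by (auto simp: data_edge_def; presburger)
  next
    fix i j assume "i \<in> X" "j \<in> Q"
    then have "i < N" "i \<noteq> j"
      using assms by auto
    then have "data_edge i \<inter> query_edge N j = {}"
      by (auto simp: data_edge_def query_edge_def; presburger)
    then show "data_edge i \<inter> query_edge N j = {}" "query_edge N j \<inter> data_edge i = {}"
      by blast+
  next
    fix i j assume "i \<in> Q" "j \<in> Q" "query_edge N i \<noteq> query_edge N j"
    then have "i < N" "j < N" "i \<noteq> j"
      using assms by auto
    then show "query_edge N i \<inter> query_edge N j = {}"
      by (auto simp: query_edge_def)
  qed
qed

text \<open>An edge of gadget \<open>i\<close> is recognised by its centre \<open>2 * i + 1\<close>, the only vertex that both
  edges of the gadget share.\<close>

lemma max_matching_size_gadget_graph:
  assumes "X \<subseteq> {..<N}" "Q \<subseteq> {..<N}"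
  shows "max_matching_size (gadget_graph N X Q) = card (X \<union> Q)"
proof (rule max_matching_size_eqI)
  have fin: "finite X" "finite Q"
    using assms finite_subset by blast+
  then show finE: "finite (gadget_graph N X Q)"
    by (simp add: gadget_graph_def)
  \<comment> \<open>The witness takes the data edge where there is one, and the query edge only in
    gadgets without a data edge.\<close>
  have sub: "gadget_graph N X (Q - X) \<subseteq> gadget_graph N X Q"
    by (intro gadget_graph_mono) auto
  show "is_matching (gadget_graph N X Q) (gadget_graph N X (Q - X))"
    unfolding is_matching_def
    using sub assms by (auto intro!: disjoint_gadget_matching)
  have "card (gadget_graph N X (Q - X)) = card (data_edge ` X) + card (query_edge N ` (Q - X))"
    unfolding gadget_graph_def using fin assms
    by (intro card_Un_disjoint) (auto simp: data_edge_neq_query_edge subset_eq)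
  also have "\<dots> = card X + card (Q - X)"
    by (simp add: card_image inj_on_def data_edge_eq_iff query_edge_eq_iff)
  also have "\<dots> = card (X \<union> Q)"
    using fin by (subst card_Un_disjoint[symmetric]) auto
  finally show "card (gadget_graph N X (Q - X)) = card (X \<union> Q)" .
  fix M assume M: "is_matching (gadget_graph N X Q) M"
  have "\<exists>i. i \<in> X \<union> Q \<and> 2 * i + 1 \<in> e" if "e \<in> M" for e
    using that M by (force simp: is_matching_def gadget_graph_def data_edge_def query_edge_def)
  then obtain c where c: "\<And>e. e \<in> M \<Longrightarrow> c e \<in> X \<union> Q \<and> 2 * c e + 1 \<in> e"
    by metis
  have "inj_on c M"
  proof (rule inj_onI)
    fix a b assume "a \<in> M" "b \<in> M" "c a = c b"
    then have "a \<inter> b \<noteq> {}"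
      using c by (metis IntI empty_iff)
    then show "a = b"
      using M \<open>a \<in> M\<close> \<open>b \<in> M\<close> by (auto simp: is_matching_def disjoint_def)
  qed
  moreover have "c ` M \<subseteq> X \<union> Q"
    using c by blast
  ultimately show "card M \<le> card (X \<union> Q)"
    using fin by (metis card_inj_on_le finite_UnI)
qed

section \<open>Bipartiteness, degree and acyclicity of gadget subgraphs\<close>

text \<open>A leaf determines its gadget, hence its only possible edge: halve the number of a data
  leaf, subtract \<open>2 * N\<close> from that of a query leaf.\<close>

lemma gadget_leaf_unique:
  assumes "E \<subseteq> gadget_graph N {..<N} {..<N}" "e \<in> E" "e' \<in> E" "v \<in> e" "v \<in> e'"
    and leaf: "even v \<or> 2 * N \<le> v"
  shows "e = e'"
proof -
  have "f = (if v < 2 * N then data_edge (v div 2) else query_edge N (v - 2 * N))"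
    if f: "f \<in> E" "v \<in> f" for f
  proof -
    have "f \<in> gadget_graph N {..<N} {..<N}"
      using f assms(1) by blast
    then show ?thesis
    proof (cases rule: gadget_edge_cases)
      case (data i)
      then have "v = 2 * i \<or> v = 2 * i + 1" "i < N"
        using f by (auto simp: data_edge_def)
      then show ?thesis
        using data by auto
    next
      case (query i)
      then have "v = 2 * i + 1 \<or> v = 2 * N + i" "i < N"
        using f by (auto simp: query_edge_def)
      then show ?thesis
        using query leaf by auto
    qed
  qed
  then show ?thesis
    using assms(2-5) by metis
qed

text \<open>Here \<open>u\<close> is the centre and \<open>v\<close> the leaf. This gives the
  bipartition and supplies the leaf in the cycle argument.\<close>

lemma gadget_edge_split:
  assumes "e \<in> gadget_graph N {..<N} {..<N}"
  shows "\<exists>u v. odd u \<and> u < 2 * N \<and> (even v \<or> 2 * N \<le> v) \<and> e = {u, v}"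
  using assms
proof (cases rule: gadget_edge_cases)
  case (data i)
  then show ?thesis
    by (intro exI[of _ "2 * i + 1"] exI[of _ "2 * i"]) (auto simp: data_edge_def)
next
  case (query i)
  then show ?thesis
    by (intro exI[of _ "2 * i + 1"] exI[of _ "2 * N + i"]) (auto simp: query_edge_def)
qed

lemma bipartite_gadget_subgraph:
  assumes "E \<subseteq> gadget_graph N {..<N} {..<N}"
  shows "bipartite E"
  unfolding bipartite_def
proof (intro exI conjI ballI)
  show "{u. odd u \<and> u < 2 * N} \<inter> {v. even v \<or> 2 * N \<le> v} = {}"
    by auto
  fix e assume "e \<in> E"
  then have "e \<in> gadget_graph N {..<N} {..<N}"
    using assms by blast
  from gadget_edge_split[OF this]
  show "\<exists>u\<in>{u. odd u \<and> u < 2 * N}. \<exists>v\<in>{v. even v \<or> 2 * N \<le> v}. e = {u, v}"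
    by blast
qed

lemma degree_gadget_subgraph_le:
  assumes "E \<subseteq> gadget_graph N {..<N} {..<N}"
  shows "degree E v \<le> 2"
proof (cases "even v \<or> 2 * N \<le> v")
  case True
  have "card {e \<in> E. v \<in> e} \<le> 1"
  proof (rule card_le_Suc0_iff_eq[THEN iffD2, folded One_nat_def])
    show "finite {e \<in> E. v \<in> e}"
      using finite_subset[OF assms] by (simp add: gadget_graph_def)
  qed (use gadget_leaf_unique[OF assms] True in blast)
  then show ?thesis
    by (simp add: degree_def)
next
  case False
  have "{e \<in> E. v \<in> e} \<subseteq> {data_edge (v div 2), query_edge N (v div 2)}"
  proof (rule subsetI)
    fix e assume e: "e \<in> {e \<in> E. v \<in> e}"
    then have "e \<in> gadget_graph N {..<N} {..<N}"
      using assms by auto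
    then show "e \<in> {data_edge (v div 2), query_edge N (v div 2)}"
    proof (cases rule: gadget_edge_cases)
      case (data i)
      then have "v = 2 * i + 1"
        using e False by (auto simp: data_edge_def)
      then show ?thesis
        using data by simp
    next
      case (query i)
      then have "v = 2 * i + 1"
        using e False by (auto simp: query_edge_def)
      then show ?thesis
        using query by simp
    qed
  qed
  then have "card {e \<in> E. v \<in> e} \<le> card {data_edge (v div 2), query_edge N (v div 2)}"
    by (intro card_mono) auto
  also have "\<dots> \<le> 2"
    by (simp add: card_insert_if)
  finally show ?thesis
    by (simp add: degree_def)
qed

text \<open>The first edge of a cycle has a leaf as an end. The other cycle edge at that leaf must
  be the same edge, so two distinct vertices of the cycle would coincide.\<close>

lemma forest_gadget_subgraph:
  assumes E: "E \<subseteq> gadget_graph N {..<N} {..<N}"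
  shows "forest E"
  unfolding forest_def
proof clarify
  fix vs assume "is_cycle E vs"
  then have len: "3 \<le> length vs" and dist: "distinct vs"
    and edge: "\<And>i. i < length vs \<Longrightarrow> {vs ! i, vs ! (Suc i mod length vs)} \<in> E"
    by (auto simp: is_cycle_def)
  define l where "l = length vs - 1"
  have l: "l < length vs" "Suc l = length vs"
    using len by (auto simp: l_def)
  have last: "{vs ! l, vs ! 0} \<in> E"
    using edge[OF l(1)] l(2) by simp
  have e0: "{vs ! 0, vs ! 1} \<in> E"
    using edge[of 0] len by fastforce
  have e1: "{vs ! 1, vs ! 2} \<in> E"
    using edge[of 1] len by (simp add: numeral_2_eq_2)
  have "0 < length vs" "1 < length vs" "2 < length vs"
    using len by linarith+
  then have "vs ! 0 \<noteq> vs ! 2" "vs ! l \<noteq> vs ! 1"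
    using nth_eq_iff_index_eq[OF dist, of 0 2] nth_eq_iff_index_eq[OF dist l(1), of 1] l(2) by auto
  moreover obtain u v where leaf: "even v \<or> 2 * N \<le> v" and uv: "{vs ! 0, vs ! 1} = {u, v}"
    using gadget_edge_split[OF subsetD[OF E e0]] by metis
  have "v = vs ! 0 \<or> v = vs ! 1"
    using uv by (metis doubleton_eq_iff)
  then have "{vs ! l, vs ! 0} = {vs ! 0, vs ! 1} \<or> {vs ! 0, vs ! 1} = {vs ! 1, vs ! 2}"
    using gadget_leaf_unique[OF E last e0 _ _ leaf] gadget_leaf_unique[OF E e0 e1 _ _ leaf] by blast
  ultimately show False
    by (metis doubleton_eq_iff)
qed

lemma arboricity_le_1_if_forest:
  assumes "forest E"
  shows "arboricity E \<le> 1"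
proof -
  \<comment> \<open>\<open>partition_on\<close> forbids empty blocks, so the empty graph is
    partitioned into no forests at all.\<close>
  define P where "P = (if E = {} then {} else {E})"
  have "partition_on E P \<and> finite P \<and> card P = card P \<and> (\<forall>F\<in>P. forest F)"
    using assms by (auto simp: P_def partition_on_def disjoint_def)
  then have "arboricity E \<le> card P"
    unfolding arboricity_def by (intro Least_le exI)
  also have "\<dots> \<le> 1"
    by (simp add: P_def)
  finally show ?thesis .
qed

section \<open>The attack stream\<close>

text \<open>An absent element still takes one timestep, as \<open>Noop\<close>; hence secrets that
  differ in one element give edge-neighboring streams.\<close>

definition data_phase :: "nat \<Rightarrow> nat set \<Rightarrow> update list" where
  "data_phase N X = map (\<lambda>j. if j \<in> X then Ins (data_edge j) else Noop) [0..<N]"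

text \<open>Every query edge is set or cleared whatever its previous state, so each phase has length
  \<open>N\<close> and overwrites the query before it.\<close>

definition query_phase :: "nat \<Rightarrow> nat set \<Rightarrow> update list" where
  "query_phase N Q =
     map (\<lambda>j. if j \<in> Q then Ins (query_edge N j) else Del (query_edge N j)) [0..<N]"

definition attack_stream :: "nat \<Rightarrow> nat \<Rightarrow> nat set list \<Rightarrow> nat set \<Rightarrow> update list" where
  "attack_stream N T Qs X = data_phase N X @ concat (map (query_phase N) Qs) @
     replicate (T - N * Suc (length Qs)) Noop"

lemma length_data_phase: "length (data_phase N X) = N"
  by (simp add: data_phase_def)

lemma length_queries: "length (concat (map (query_phase N) Qs)) = N * length Qs"
  by (induction Qs) (auto simp: query_phase_def)

lemma length_attack_stream:
  "N * Suc (length Qs) \<le> T \<Longrightarrow> length (attack_stream N T Qs X) = T"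
  by (simp add: attack_stream_def length_data_phase length_queries)

lemma fold_data_phase:
  assumes "X \<subseteq> {..<N}"
  shows "fold apply_update (data_phase N X) {} = gadget_graph N X {}"
proof -
  have "fold apply_update (map (\<lambda>j. if j \<in> X then Ins (data_edge j) else Noop) [0..<k]) {} =
      data_edge ` (X \<inter> {..<k})" for k
    by (induction k) (auto simp: lessThan_Suc)
  then show ?thesis
    using assms by (simp add: data_phase_def gadget_graph_def Int_absorb2)
qed

lemma fold_query_phase:
  assumes "X \<subseteq> {..<N}" "Q' \<subseteq> {..<N}" "Q \<subseteq> {..<N}"
  shows "fold apply_update (query_phase N Q) (gadget_graph N X Q') = gadget_graph N X Q"
proof -
  \<comment> \<open>After \<open>k\<close> updates the first \<open>k\<close> gadgets show the new
    query and the others still the old one.\<close>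
  have "fold apply_update
      (map (\<lambda>j. if j \<in> Q then Ins (query_edge N j) else Del (query_edge N j)) [0..<k])
      (gadget_graph N X Q') = gadget_graph N X (Q \<inter> {..<k} \<union> (Q' - {..<k}))" for k
  proof (induction k)
    case (Suc k)
    show ?case
    proof (cases "k \<in> Q")
      case True
      then have "Q \<inter> {..<Suc k} \<union> (Q' - {..<Suc k}) \<union> {k} =
          insert k (Q \<inter> {..<k} \<union> (Q' - {..<k}))" "k \<in> Q \<inter> {..<Suc k} \<union> (Q' - {..<Suc k})"
        by auto
      then show ?thesis
        using True Suc by (auto simp: gadget_graph_def)
    next
      case False
      then have "Q \<inter> {..<Suc k} \<union> (Q' - {..<Suc k}) = Q \<inter> {..<k} \<union> (Q' - {..<k}) - {k}"
        by (auto simp: less_Suc_eq)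
      moreover have "gadget_graph N X (R - {k}) = gadget_graph N X R - {query_edge N k}" for R
      proof -
        have "query_edge N k \<notin> data_edge ` X"
          using assms(1) data_edge_neq_query_edge by (metis imageE lessThan_iff subsetD)
        moreover have "query_edge N ` (R - {k}) = query_edge N ` R - {query_edge N k}"
          by (auto simp: query_edge_eq_iff)
        ultimately show ?thesis
          by (simp add: gadget_graph_def Un_Diff)
      qed
      ultimately show ?thesis
        using False Suc by simp
    qed
  qed (simp add: gadget_graph_def)
  from this[of N] show ?thesis
    using assms by (simp add: query_phase_def Int_absorb2 Diff_eq_empty_iff[THEN iffD2])
qed

lemma fold_queries:
  assumes "X \<subseteq> {..<N}" "Q \<subseteq> {..<N}" "\<And>Q'. Q' \<in> set Qs \<Longrightarrow> Q' \<subseteq> {..<N}"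
  shows "fold apply_update (concat (map (query_phase N) Qs)) (gadget_graph N X Q) =
    gadget_graph N X (last (Q # Qs))"
  using assms by (induction Qs arbitrary: Q) (auto simp: fold_query_phase)

lemma graph_at_attack_stream:
  assumes X: "X \<subseteq> {..<N}" and Qs: "\<And>Q. Q \<in> set Qs \<Longrightarrow> Q \<subseteq> {..<N}" and j: "j \<le> length Qs"
  shows "graph_at (attack_stream N T Qs X) (N * Suc j) =
    gadget_graph N X (if j = 0 then {} else Qs ! (j - 1))"
proof -
  have "concat (map (query_phase N) Qs) =
      concat (map (query_phase N) (take j Qs)) @ concat (map (query_phase N) (drop j Qs))"
    by (metis append_take_drop_id concat_append map_append)
  then have "take (N * Suc j) (attack_stream N T Qs X) =
      data_phase N X @ concat (map (query_phase N) (take j Qs))"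
    using j by (simp add: attack_stream_def length_data_phase length_queries)
  moreover have "last ({} # take j Qs) = (if j = 0 then {} else Qs ! (j - 1))"
    using j by (auto simp: last_conv_nth min_def)
  moreover have "fold apply_update (concat (map (query_phase N) (take j Qs))) (gadget_graph N X {}) =
      gadget_graph N X (last ({} # take j Qs))"
    using X by (rule fold_queries) (auto dest!: Qs in_set_takeD)
  ultimately show ?thesis
    by (simp only: graph_at_def fold_append o_apply fold_data_phase[OF X])
qed

text \<open>This controls the graph in the middle of a phase too: attack streams only ever insert
  gadget edges, and the structural bounds hold for every subgraph of the gadget graph.\<close>

lemma graph_at_subset_inserted: "graph_at S t \<subseteq> {e. Ins e \<in> set S}"
proof -
  have "fold apply_update us E \<subseteq> E \<union> {e. Ins e \<in> set us}" for us E
  proof (induction us arbitrary: E)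
    case (Cons u us)
    then show ?case
      by (cases u) fastforce+
  qed simp
  from this[of "take t S" "{}"] show ?thesis
    unfolding graph_at_def by (auto dest: in_set_takeD)
qed

lemma attack_stream_update_cases:
  assumes "u \<in> set (attack_stream N T Qs X)"
  obtains "u = Noop"
    | j where "j < N" "u = Ins (data_edge j)"
    | j where "Qs \<noteq> []" "j < N" "u = Ins (query_edge N j) \<or> u = Del (query_edge N j)"
proof -
  consider "u \<in> set (data_phase N X)"
    | Q where "Q \<in> set Qs" "u \<in> set (query_phase N Q)" | "u = Noop"
    using assms by (auto simp: attack_stream_def)
  then show thesis
  proof cases
    case 1
    then show thesis
      using that(1,2) by (auto simp: data_phase_def split: if_splits)
  next
    case 2
    then have "Qs \<noteq> []"
      by auto
    then show thesis
      using 2 that(3) by (auto simp: query_phase_def split: if_splits)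
  qed (rule that(1))
qed

lemma attack_stream_restricted:
  assumes "2 * N \<le> n" "Qs \<noteq> [] \<Longrightarrow> 3 * N \<le> n" "N * Suc (length Qs) \<le> T" "1 \<le> n"
  shows "attack_stream N T Qs X \<in> restricted_streams n T"
proof -
  let ?S = "attack_stream N T Qs X"
  have data: "data_edge j \<in> all_edges n" if "j < N" for j
    unfolding all_edges_def data_edge_def using that assms(1)
    by (intro CollectI exI[of _ "2 * j"] exI[of _ "2 * j + 1"]) auto
  have query: "query_edge N j \<in> all_edges n" if "j < N" "Qs \<noteq> []" for j
    unfolding all_edges_def query_edge_def using that assms(2)
    by (intro CollectI exI[of _ "2 * j + 1"] exI[of _ "2 * N + j"]) auto
  have "set ?S \<subseteq> updates n"
  proof
    fix u assume "u \<in> set ?S"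
    then show "u \<in> updates n"
      by (cases rule: attack_stream_update_cases) (use data query in \<open>auto simp: updates_def\<close>)
  qed
  then have "?S \<in> streams_of n T"
    using assms by (simp add: streams_of_def length_attack_stream)
  moreover have sub: "graph_at ?S t \<subseteq> gadget_graph N {..<N} {..<N}" for t
  proof
    fix e assume "e \<in> graph_at ?S t"
    then have "Ins e \<in> set ?S"
      using graph_at_subset_inserted by blast
    then show "e \<in> gadget_graph N {..<N} {..<N}"
      by (cases rule: attack_stream_update_cases) (auto simp: gadget_graph_def)
  qed
  moreover have "max_degree n (graph_at ?S t) \<le> 2" for t
    unfolding max_degree_def using assms(4) degree_gadget_subgraph_le[OF sub]
    by (auto simp: lessThan_empty_iff)
  ultimately show ?thesis
    using bipartite_gadget_subgraph[OF sub]
      arboricity_le_1_if_forest[OF forest_gadget_subgraph[OF sub]]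
    by (simp add: restricted_streams_def)
qed

section \<open>Privacy of the secret set\<close>

lemma edge_neighboring_attack_stream:
  assumes "j < N"
  shows "edge_neighboring (attack_stream N T Qs (sym_diff X {j})) (attack_stream N T Qs X)"
proof -
  define R where "R = concat (map (query_phase N) Qs) @ replicate (T - N * Suc (length Qs)) Noop"
  have eq: "attack_stream N T Qs Z = data_phase N Z @ R" for Z
    by (simp add: attack_stream_def R_def)
  have nth: "(data_phase N Z @ R) ! i =
      (if i < N then if i \<in> Z then Ins (data_edge i) else Noop else R ! (i - N))" for Z i
    by (simp add: nth_append length_data_phase) (simp add: data_phase_def)
  show ?thesis
    unfolding edge_neighboring_def eq nth using assms
    by (intro conjI exI[of _ j]) (auto simp: length_data_phase)
qed

text \<open>The elements of \<open>D\<close> are flipped one at a time; each flip costs a factor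
  \<open>exp \<epsilon>\<close>.\<close>

lemma attack_stream_group_privacy:
  assumes dp: "edge_DP n T \<epsilon> A"
    and str: "\<And>X. attack_stream N T Qs X \<in> streams_of n T"
    and Y: "Y \<in> sets (output_space T)" and D: "D \<subseteq> {..<N}"
  shows "measure (A (attack_stream N T Qs (sym_diff X D))) Y \<le>
    exp (\<epsilon> * card D) * measure (A (attack_stream N T Qs X)) Y"
proof -
  have "finite D"
    using D finite_subset by blast
  then show ?thesis
    using D
  proof induction
    case (insert d D)
    have "sym_diff X (insert d D) = sym_diff (sym_diff X D) {d}"
      using insert.hyps by auto
    then have "measure (A (attack_stream N T Qs (sym_diff X (insert d D)))) Y \<le>
        exp \<epsilon> * measure (A (attack_stream N T Qs (sym_diff X D))) Y"
      using dp str Y edge_neighboring_attack_stream[of d N T Qs "sym_diff X D"] insert.prems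
      unfolding edge_DP_def by simp
    also have "\<dots> \<le> exp \<epsilon> * (exp (\<epsilon> * card D) * measure (A (attack_stream N T Qs X)) Y)"
      using insert by simp
    also have "\<dots> = exp (\<epsilon> * card (insert d D)) * measure (A (attack_stream N T Qs X)) Y"
      using insert.hyps by (simp add: exp_add[symmetric] algebra_simps)
    finally show ?case .
  qed simp
qed

section \<open>Reconstruction against privacy\<close>

text \<open>The event \<open>dec i\<close> means that bit \<open>i\<close> is decoded as present.
  Averaged over all secrets and bits, accuracy makes the failure probability at most
  \<open>1 / 10 + 1 / 100\<close>, while privacy makes it at least \<open>1 / (1 + exp 1)\<close>,
  which is at least \<open>1 / 4\<close>.\<close>

lemma no_private_reconstruction:
  fixes \<mu> :: "nat set \<Rightarrow> 'a measure" and m :: nat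
  assumes m: "1 \<le> m"
    and prob: "\<And>Y. Y \<subseteq> {..<m} \<Longrightarrow> prob_space (\<mu> Y)"
    and sets: "\<And>Y. Y \<subseteq> {..<m} \<Longrightarrow> sets (\<mu> Y) = sets M"
    and dec: "\<And>i. i < m \<Longrightarrow> dec i \<in> sets M"
    and G: "\<And>Y. Y \<subseteq> {..<m} \<Longrightarrow> G Y \<in> sets M \<and> measure (\<mu> Y) (G Y) \<ge> 99 / 100"
    and few: "\<And>Y w. Y \<subseteq> {..<m} \<Longrightarrow> w \<in> G Y \<Longrightarrow>
      real (card {i \<in> {..<m}. (w \<in> dec i) \<noteq> (i \<in> Y)}) \<le> m / 10"
    and dp: "\<And>Y i E. Y \<subseteq> {..<m} \<Longrightarrow> i < m \<Longrightarrow> E \<in> sets M \<Longrightarrow>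
      measure (\<mu> Y) E \<le> exp 1 * measure (\<mu> (sym_diff Y {i})) E"
  shows False
proof -
  define bad where "bad i Y = (if i \<in> Y then space M - dec i else dec i)" for i and Y :: "nat set"
  have bad_sets: "bad i Y \<in> sets M" if "i < m" for i Y
    using dec[OF that] by (auto simp: bad_def)
  let ?S = "\<Sum>Y\<in>Pow {..<m}. \<Sum>i<m. measure (\<mu> Y) (bad i Y)"
  have upper: "(\<Sum>i<m. measure (\<mu> Y) (bad i Y)) \<le> 11 / 100 * m" if Y: "Y \<subseteq> {..<m}" for Y
  proof -
    interpret prob_space "\<mu> Y" by (rule prob[OF Y])
    note [simp] = sets[OF Y]
    have sp: "space (\<mu> Y) = space M"
      using sets[OF Y] by (rule sets_eq_imp_space_eq)
    have GY: "G Y \<in> sets M" "prob (G Y) \<ge> 99 / 100"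
      using G[OF Y] by auto
    have split: "prob (bad i Y) \<le> prob (bad i Y \<inter> G Y) + 1 / 100" if "i < m" for i
    proof -
      have "prob (bad i Y) = prob (bad i Y \<inter> G Y) + prob (bad i Y - G Y)"
        using GY bad_sets[OF that] by (subst finite_measure_Union[symmetric]) (auto simp: Int_Diff_Un)
      moreover have "prob (bad i Y - G Y) \<le> prob (space (\<mu> Y) - G Y)"
        using GY bad_sets[OF that, THEN sets.sets_into_space]
        by (intro finite_measure_mono) (auto simp: sp)
      moreover have "prob (space (\<mu> Y) - G Y) = 1 - prob (G Y)"
        using GY by (intro prob_compl) simp
      ultimately show ?thesis
        using GY by linarith
    qed
    have int: "integrable (\<mu> Y) (indicator (bad i Y \<inter> G Y) :: _ \<Rightarrow> real)" if "i < m" for i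
      using GY bad_sets[OF that] by (intro integrable_real_indicator) (auto simp: emeasure_eq_measure)
    \<comment> \<open>The sum is the expected number of wrong bits on the accurate event, where
      \<open>few\<close> bounds that number pointwise.\<close>
    have "(\<Sum>i<m. prob (bad i Y \<inter> G Y)) = expectation (\<lambda>w. \<Sum>i<m. indicator (bad i Y \<inter> G Y) w)"
      using int bad_sets GY by (subst Bochner_Integration.integral_sum) auto
    also have "\<dots> \<le> expectation (\<lambda>_. m / 10)"
    proof (rule integral_mono)
      fix w assume "w \<in> space (\<mu> Y)"
      then have w: "w \<in> space M" by (simp add: sp)
      show "(\<Sum>i<m. indicator (bad i Y \<inter> G Y) w) \<le> real m / 10"
      proof (cases "w \<in> G Y")
        case True
        have "(\<Sum>i<m. indicator (bad i Y \<inter> G Y) w :: real) =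
            (\<Sum>i<m. if (w \<in> dec i) \<noteq> (i \<in> Y) then 1 else 0)"
          using True w by (intro sum.cong) (auto simp: bad_def indicator_def)
        also have "\<dots> = real (card {i \<in> {..<m}. (w \<in> dec i) \<noteq> (i \<in> Y)})"
          by (simp add: sum.If_cases Int_def)
        finally show ?thesis
          using few[OF Y True] by simp
      qed simp
    qed (use int in auto)
    finally have "(\<Sum>i<m. prob (bad i Y \<inter> G Y)) \<le> m / 10"
      by (simp add: prob_space)
    moreover have "(\<Sum>i<m. prob (bad i Y)) \<le> (\<Sum>i<m. prob (bad i Y \<inter> G Y) + 1 / 100)"
      using split by (intro sum_mono) auto
    ultimately show ?thesis
      by (simp add: sum.distrib)
  qed
  \<comment> \<open>Decoding bit \<open>i\<close> of \<open>Y\<close> correctly is the same event as decoding bit \<open>i\<close> of the flipped set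
    wrongly, so privacy bounds the success probability by the failure probability.\<close>
  have lower: "2 ^ m - (\<Sum>Y\<in>Pow {..<m}. measure (\<mu> Y) (bad i Y)) \<le>
      exp 1 * (\<Sum>Y\<in>Pow {..<m}. measure (\<mu> Y) (bad i Y))" if i: "i < m" for i
  proof -
    have flip: "1 - measure (\<mu> Y) (bad i Y) \<le>
        exp 1 * measure (\<mu> (sym_diff Y {i})) (bad i (sym_diff Y {i}))" if Y: "Y \<subseteq> {..<m}" for Y
    proof -
      interpret prob_space "\<mu> Y" by (rule prob[OF Y])
      have "space (\<mu> Y) = space M"
        using sets[OF Y] by (rule sets_eq_imp_space_eq)
      moreover have "dec i \<subseteq> space M"
        using dec[OF i] by (rule sets.sets_into_space)
      ultimately have "space (\<mu> Y) - bad i Y = bad i (sym_diff Y {i})"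
        by (auto simp: bad_def)
      then have "1 - measure (\<mu> Y) (bad i Y) = measure (\<mu> Y) (bad i (sym_diff Y {i}))"
        using prob_compl[of "bad i Y"] bad_sets[OF i] sets[OF Y] by simp
      then show ?thesis
        using dp[OF Y i bad_sets[OF i]] by simp
    qed
    have "(\<Sum>Y\<in>Pow {..<m}. 1 - measure (\<mu> Y) (bad i Y)) \<le>
        exp 1 * (\<Sum>Y\<in>Pow {..<m}. measure (\<mu> (sym_diff Y {i})) (bad i (sym_diff Y {i})))"
      unfolding sum_distrib_left using flip by (intro sum_mono) auto
    \<comment> \<open>Flipping bit \<open>i\<close> is an involution on the secrets, so it only
      permutes the summands.\<close>
    also have "(\<Sum>Y\<in>Pow {..<m}. measure (\<mu> (sym_diff Y {i})) (bad i (sym_diff Y {i}))) =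
        (\<Sum>Y\<in>Pow {..<m}. measure (\<mu> Y) (bad i Y))"
      using i by (intro sum.reindex_bij_witness[where i = "\<lambda>Y. sym_diff Y {i}"
          and j = "\<lambda>Y. sym_diff Y {i}"]) auto
    finally show ?thesis
      by (simp add: sum_subtractf card_Pow)
  qed
  have swap: "?S = (\<Sum>i<m. \<Sum>Y\<in>Pow {..<m}. measure (\<mu> Y) (bad i Y))"
    by (rule sum.swap)
  have "(\<Sum>i<m. 2 ^ m - (\<Sum>Y\<in>Pow {..<m}. measure (\<mu> Y) (bad i Y))) \<le> exp 1 * ?S"
    unfolding swap sum_distrib_left using lower by (intro sum_mono) (auto simp: sum_distrib_left)
  then have "m * 2 ^ m - ?S \<le> exp 1 * ?S"
    unfolding swap by (simp add: sum_subtractf)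
  also have "\<dots> \<le> 3 * ?S"
    using exp_le by (intro mult_right_mono sum_nonneg) auto
  finally have "m * 2 ^ m \<le> 4 * ?S"
    by simp
  also have "?S \<le> (\<Sum>Y\<in>Pow {..<m}. 11 / 100 * m)"
    using upper by (intro sum_mono) auto
  finally have "real m * 2 ^ m \<le> 44 / 100 * (real m * 2 ^ m)"
    by (simp add: card_Pow)
  moreover have "real m * 2 ^ m > 0"
    using m by simp
  ultimately show False
    by linarith
qed

section \<open>Hadamard matrices and decoding\<close>

text \<open>Sylvester's doubling construction. Symmetry and the constant row \<open>0\<close> are
  carried along because decoding uses them.\<close>

lemma hadamard_matrix_exists:
  "\<exists>h :: nat \<Rightarrow> nat \<Rightarrow> real. (\<forall>j i. h j i = 1 \<or> h j i = - 1) \<and> (\<forall>i. h 0 i = 1) \<and>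
     (\<forall>j i. h j i = h i j) \<and>
     (\<forall>i<2 ^ r. \<forall>k<2 ^ r. (\<Sum>j<2 ^ r. h j i * h j k) = (if i = k then 2 ^ r else 0))"
proof (induction r)
  case 0
  show ?case
    by (rule exI[of _ "\<lambda>_ _. 1"]) simp
next
  case (Suc r)
  then obtain h :: "nat \<Rightarrow> nat \<Rightarrow> real" where h: "\<And>j i. h j i = 1 \<or> h j i = - 1" "\<And>i. h 0 i = 1"
    "\<And>j i. h j i = h i j"
    "\<And>i k. i < 2 ^ r \<Longrightarrow> k < 2 ^ r \<Longrightarrow> (\<Sum>j<2 ^ r. h j i * h j k) = (if i = k then 2 ^ r else 0)"
    by blast
  define m :: nat where "m = 2 ^ r"
  have m: "0 < m" by (simp add: m_def)
  \<comment> \<open>The block matrix with rows \<open>(h, h)\<close> and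
    \<open>(h, - h)\<close>.\<close>
  define g where "g j i = h (j mod m) (i mod m) * (if m \<le> j \<and> m \<le> i then - 1 else 1)" for j i
  have "(\<Sum>j<2 ^ Suc r. g j i * g j k) = (if i = k then 2 ^ Suc r else 0)"
    if "i < 2 ^ Suc r" "k < 2 ^ Suc r" for i k
  proof -
    \<comment> \<open>The lower half repeats the inner product of the upper half with sign
      \<open>s i * s k\<close>. Columns from different halves thus cancel, and columns from the same
      half double it.\<close>
    define s :: "nat \<Rightarrow> real" where "s i = (if m \<le> i then - 1 else 1)" for i
    have ik: "i < m + m" "k < m + m"
      using that by (auto simp: m_def)
    have "(\<Sum>j<m + l. g j i * g j k) =
        (\<Sum>j<m. g j i * g j k) + (\<Sum>j<l. g (m + j) i * g (m + j) k)" for l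
      by (induction l) simp_all
    from this[of m] have "(\<Sum>j<2 ^ Suc r. g j i * g j k) =
        (\<Sum>j<m. g j i * g j k) + (\<Sum>j<m. g (m + j) i * g (m + j) k)"
      by (simp add: m_def mult_2)
    also have "(\<Sum>j<m. g j i * g j k) = (\<Sum>j<m. h j (i mod m) * h j (k mod m))"
      by (intro sum.cong) (auto simp: g_def)
    also have "(\<Sum>j<m. g (m + j) i * g (m + j) k) = s i * s k * (\<Sum>j<m. h j (i mod m) * h j (k mod m))"
      unfolding sum_distrib_left by (intro sum.cong) (auto simp: g_def s_def)
    also have "(\<Sum>j<m. h j (i mod m) * h j (k mod m)) = (if i mod m = k mod m then m else 0)"
      using h(4)[of "i mod m" "k mod m"] m by (simp add: m_def)
    finally have *: "(\<Sum>j<2 ^ Suc r. g j i * g j k) = (1 + s i * s k) * (if i mod m = k mod m then m else 0)"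
      by (simp add: algebra_simps)
    show ?thesis
    proof (cases "(m \<le> i) = (m \<le> k)")
      case True
      then have "i mod m = k mod m \<longleftrightarrow> i = k"
        using ik by (auto simp: mod_if)
      then show ?thesis
        using True * by (auto simp: s_def m_def)
    next
      case False
      then show ?thesis
        using * by (auto simp: s_def)
    qed
  qed
  moreover have "g j i = 1 \<or> g j i = - 1" for j i
    using h(1)[of "j mod m" "i mod m"] by (auto simp: g_def)
  moreover have "g 0 i = 1" "g j i = g i j" for i j
    using h(2)[of "i mod m"] h(3)[of "j mod m" "i mod m"] m by (auto simp: g_def)
  ultimately show ?case
    by (intro exI[of _ g]) blast
qed

text \<open>Matchings count unions, so a row with entries \<open>1\<close> and \<open>- 1\<close> is
  queried through its negative entries: with \<open>N\<close> their set,
  \<open>card (Y \<union> N) - card N\<close> counts the elements of \<open>Y\<close> at positive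
  entries, and twice this minus \<open>card Y\<close> is the inner product.\<close>

definition negative_columns :: "nat \<Rightarrow> (nat \<Rightarrow> nat \<Rightarrow> real) \<Rightarrow> nat \<Rightarrow> nat set" where
  "negative_columns m h j = {i \<in> {..<m}. h j i = - 1}"

text \<open>Row \<open>0\<close> of \<open>h\<close> is constantly \<open>1\<close>, so \<open>u 0\<close> estimates \<open>card Y\<close> and the inner bracket estimates the
  inner product of row \<open>j\<close> with the indicator vector of \<open>Y\<close>; orthogonality inverts the transform.\<close>

definition hadamard_decode ::
    "nat \<Rightarrow> (nat \<Rightarrow> nat \<Rightarrow> real) \<Rightarrow> (nat \<Rightarrow> real) \<Rightarrow> nat \<Rightarrow> real" where
  "hadamard_decode m h u i =
     (\<Sum>j<m. h j i * (2 * (u j - card (negative_columns m h j)) - u 0)) / m"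

text \<open>Each inner product is estimated within \<open>3 * \<eta>\<close>: twice the error of
  \<open>u j\<close> plus that of \<open>u 0\<close>. Since \<open>h / sqrt m\<close> is orthogonal,
  the squared error of the decoded vector is the mean of the squared errors
  \<open>v j\<close>.\<close>

lemma hadamard_decode_error:
  fixes h :: "nat \<Rightarrow> nat \<Rightarrow> real" and u :: "nat \<Rightarrow> real"
  assumes h: "\<And>j i. h j i = 1 \<or> h j i = - 1" "\<And>i. h 0 i = 1" "\<And>j i. h j i = h i j"
    and orth: "\<And>i k. i < m \<Longrightarrow> k < m \<Longrightarrow> (\<Sum>j<m. h j i * h j k) = (if i = k then real m else 0)"
    and m: "1 \<le> m" and Y: "Y \<subseteq> {..<m}"
    and u: "\<And>j. j < m \<Longrightarrow> \<bar>u j - card (Y \<union> negative_columns m h j)\<bar> \<le> \<eta>"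
  shows "(\<Sum>i<m. (hadamard_decode m h u i - of_bool (i \<in> Y))\<^sup>2) \<le> 9 * \<eta>\<^sup>2"
proof -
  define N where "N = negative_columns m h"
  define v where "v j = 2 * (u j - card (N j)) - u 0 - (\<Sum>k<m. h j k * of_bool (k \<in> Y))" for j
  have N0: "N 0 = {}"
    using h(2) by (auto simp: N_def negative_columns_def)
  have inner: "(\<Sum>k<m. h j k * of_bool (k \<in> Y)) =
      2 * (real (card (Y \<union> N j)) - card (N j)) - card Y" for j
  proof -
    have card: "real (card Z) = (\<Sum>k<m. of_bool (k \<in> Z))" if "Z \<subseteq> {..<m}" for Z
      using that by (simp add: sum_of_bool_eq Int_absorb1 Int_def[symmetric])
    have Nm: "N j \<subseteq> {..<m}"
      by (auto simp: N_def negative_columns_def)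
    have "(\<Sum>k<m. h j k * of_bool (k \<in> Y)) =
        (\<Sum>k<m. 2 * (of_bool (k \<in> Y \<union> N j) - of_bool (k \<in> N j)) - of_bool (k \<in> Y))"
    proof (rule sum.cong)
      fix k assume "k \<in> {..<m}"
      then show "h j k * of_bool (k \<in> Y) =
          2 * (of_bool (k \<in> Y \<union> N j) - of_bool (k \<in> N j)) - of_bool (k \<in> Y)"
        using h(1)[of j k] by (auto simp: N_def negative_columns_def)
    qed simp
    also have "\<dots> = 2 * (real (card (Y \<union> N j)) - card (N j)) - card Y"
      using card[OF Y] card[OF Nm] card[of "Y \<union> N j"] Y Nm
      by (simp only: sum_subtractf sum_distrib_left[symmetric] Un_subset_iff)
    finally show ?thesis .
  qed
  have v: "(v j)\<^sup>2 \<le> 9 * \<eta>\<^sup>2" if "j < m" for j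
  proof -
    have "v j = 2 * (u j - card (Y \<union> N j)) - (u 0 - card Y)"
      unfolding v_def inner by (simp add: algebra_simps)
    then have "\<bar>v j\<bar> \<le> \<bar>2 * (u j - card (Y \<union> N j))\<bar> + \<bar>u 0 - card Y\<bar>"
      by (simp only: abs_triangle_ineq4)
    also have "\<dots> = 2 * \<bar>u j - card (Y \<union> N j)\<bar> + \<bar>u 0 - card Y\<bar>"
      by (simp only: abs_mult abs_numeral)
    also have "\<dots> \<le> 3 * \<eta>"
      using u[OF that] u[of 0] m N0 by (simp add: N_def)
    finally have "\<bar>v j\<bar>\<^sup>2 \<le> (3 * \<eta>)\<^sup>2"
      by (intro power_mono) auto
    then show ?thesis
      by (simp add: power_mult_distrib)
  qed
  have err: "hadamard_decode m h u i - of_bool (i \<in> Y) = (\<Sum>j<m. h j i * v j) / m" if i: "i < m" for i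
  proof -
    have "(\<Sum>j<m. h j i * (\<Sum>k<m. h j k * of_bool (k \<in> Y))) =
        (\<Sum>k<m. of_bool (k \<in> Y) * (\<Sum>j<m. h j i * h j k))"
      unfolding sum_distrib_left by (subst sum.swap) (simp add: ac_simps)
    also have "\<dots> = (\<Sum>k<m. if k = i then real m * of_bool (i \<in> Y) else 0)"
      using orth[OF i] by (intro sum.cong) auto
    also have "\<dots> = real m * of_bool (i \<in> Y)"
      using i by simp
    finally have "(\<Sum>j<m. h j i * v j) =
        (\<Sum>j<m. h j i * (2 * (u j - card (N j)) - u 0)) - m * of_bool (i \<in> Y)"
      unfolding v_def right_diff_distrib[of "h _ _" "_ - _"] sum_subtractf by simp
    then show ?thesis
      using m by (simp add: hadamard_decode_def N_def field_simps)
  qed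
  \<comment> \<open>Parseval's identity; symmetry turns the sum over columns into one over rows, to
    which \<open>orth\<close> applies.\<close>
  have "(\<Sum>i<m. (\<Sum>j<m. h j i * v j)\<^sup>2) = (\<Sum>i<m. \<Sum>j<m. \<Sum>k<m. v j * v k * (h i j * h i k))"
    unfolding power2_eq_square sum_product using h(3) by (intro sum.cong) (simp_all add: ac_simps)
  also have "\<dots> = (\<Sum>j<m. \<Sum>k<m. v j * v k * (\<Sum>i<m. h i j * h i k))"
    unfolding sum_distrib_left by (rule trans[OF sum.swap]) (intro sum.cong refl sum.swap)
  also have "\<dots> = (\<Sum>j<m. \<Sum>k<m. if k = j then real m * (v j)\<^sup>2 else 0)"
    using orth by (intro sum.cong) (auto simp: power2_eq_square)
  also have "\<dots> = m * (\<Sum>j<m. (v j)\<^sup>2)"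
    by (simp add: sum_distrib_left)
  also have "\<dots> \<le> m * (\<Sum>j<m. 9 * \<eta>\<^sup>2)"
    using v by (intro mult_left_mono sum_mono) auto
  finally have "(\<Sum>i<m. (\<Sum>j<m. h j i * v j)\<^sup>2) / (real m)\<^sup>2 \<le> 9 * \<eta>\<^sup>2"
    using m by (simp add: power2_eq_square divide_simps mult_ac)
  then show ?thesis
    by (simp add: err power_divide sum_divide_distrib[symmetric])
qed

section \<open>Lower bounds on the error\<close>

text \<open>Output \<open>N * Suc j - 1\<close> is the estimate at the end of phase \<open>j\<close>, where phase \<open>0\<close> is the data phase
  and phase \<open>j > 0\<close> asks query \<open>Qs ! (j - 1)\<close>.\<close>

definition attack_accurate ::
    "nat \<Rightarrow> nat \<Rightarrow> real \<Rightarrow> nat set list \<Rightarrow> nat set \<Rightarrow> (nat \<Rightarrow> real) set" where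
  "attack_accurate N T \<zeta> Qs X = {w \<in> space (output_space T). \<forall>j\<in>{..length Qs}.
     \<bar>w (N * Suc j - 1) - real (card (X \<union> (if j = 0 then {} else Qs ! (j - 1))))\<bar> \<le> \<zeta>}"

lemma attack_time_less:
  fixes N :: nat
  assumes "1 \<le> N" "N * Suc l \<le> T" "j \<le> l"
  shows "N * Suc j - 1 < T"
proof -
  have "N * Suc j \<le> N * Suc l"
    using assms by simp
  moreover have "0 < N * Suc j"
    using assms by simp
  ultimately show ?thesis
    using assms(2) by linarith
qed

lemma output_coordinate_measurable:
  "t < T \<Longrightarrow> (\<lambda>w. w t) \<in> borel_measurable (output_space T)"
  by (rule measurable_component_singleton) simp

lemma attack_accurate_sets:
  assumes "1 \<le> N" "N * Suc (length Qs) \<le> T"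
  shows "attack_accurate N T \<zeta> Qs X \<in> sets (output_space T)"
  unfolding attack_accurate_def
proof (rule sets.sets_Collect_finite_All')
  fix j assume "j \<in> {..length Qs}"
  then have [measurable]: "(\<lambda>w. w (N * Suc j - 1)) \<in> borel_measurable (output_space T)"
    by (intro output_coordinate_measurable attack_time_less[OF assms]) simp
  show "{w \<in> space (output_space T).
      \<bar>w (N * Suc j - 1) - real (card (X \<union> (if j = 0 then {} else Qs ! (j - 1))))\<bar> \<le> \<zeta>} \<in>
      sets (output_space T)"
    by measurable
qed auto

lemma measure_attack_accurate:
  assumes rel: "continual_release n T A"
    and acc: "matching_accurate_on (restricted_streams n T) T \<zeta> A"
    and str: "attack_stream N T Qs X \<in> restricted_streams n T"
    and N: "1 \<le> N" "N * Suc (length Qs) \<le> T"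
    and X: "X \<subseteq> {..<N}" and Qs: "\<And>Q. Q \<in> set Qs \<Longrightarrow> Q \<subseteq> {..<N}"
  shows "measure (A (attack_stream N T Qs X)) (attack_accurate N T \<zeta> Qs X) \<ge> 99 / 100"
proof -
  let ?S = "attack_stream N T Qs X"
  have "?S \<in> streams_of n T"
    using str by (simp add: restricted_streams_def)
  then have S: "prob_space (A ?S)" "sets (A ?S) = sets (output_space T)"
    using rel by (auto simp: continual_release_def)
  interpret prob_space "A ?S" by (rule S)
  have "{w \<in> space (A ?S). \<forall>t<T. \<bar>w t - real (max_matching_size (graph_at ?S (Suc t)))\<bar> \<le> \<zeta>} \<subseteq>
      attack_accurate N T \<zeta> Qs X"
  proof clarify
    fix w assume w: "w \<in> space (A ?S)"
      "\<forall>t<T. \<bar>w t - real (max_matching_size (graph_at ?S (Suc t)))\<bar> \<le> \<zeta>"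
    have "\<bar>w (N * Suc j - 1) - real (card (X \<union> (if j = 0 then {} else Qs ! (j - 1))))\<bar> \<le> \<zeta>"
      if j: "j \<le> length Qs" for j
    proof -
      have "(if j = 0 then {} else Qs ! (j - 1)) \<subseteq> {..<N}"
        using j Qs by auto
      then have "max_matching_size (graph_at ?S (N * Suc j)) =
          card (X \<union> (if j = 0 then {} else Qs ! (j - 1)))"
        using graph_at_attack_stream[OF X Qs j] max_matching_size_gadget_graph[OF X] by simp
      \<comment> \<open>Output \<open>t\<close> estimates the graph after \<open>Suc t\<close>
        updates, hence the shift by one.\<close>
      moreover have "Suc (N * Suc j - 1) = N * Suc j"
        using N by simp
      ultimately show ?thesis
        using w(2) attack_time_less[OF N j] by metis
    qed
    then show "w \<in> attack_accurate N T \<zeta> Qs X"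
      using w(1) sets_eq_imp_space_eq[OF S(2)] by (auto simp: attack_accurate_def)
  qed
  moreover have "attack_accurate N T \<zeta> Qs X \<in> events"
    using attack_accurate_sets[OF N] S(2) by simp
  ultimately show ?thesis
    using acc[unfolded matching_accurate_on_def, rule_format, OF str]
    by (rule order_trans[OF _ finite_measure_mono, rotated])
qed

text \<open>The secrets \<open>{}\<close> and \<open>{..<k}\<close> have true answers
  \<open>0\<close> and \<open>k\<close> at time \<open>k\<close>, so an error below
  \<open>k / 2\<close> makes their accurate events disjoint. Group privacy loses a factor of at most
  \<open>3\<close>, so under the empty secret they would have total probability at least
  \<open>0.99 + 0.33\<close>.\<close>

lemma two_point_error_bound:
  assumes rel: "continual_release n T A" and dp: "edge_DP n T \<epsilon> A"
    and acc: "matching_accurate_on (restricted_streams n T) T \<zeta> A"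
    and k: "1 \<le> k" "\<epsilon> * real k \<le> 1" "2 * k \<le> n" "k \<le> T"
  shows "\<zeta> \<ge> k / 2"
proof (rule ccontr)
  assume "\<not> \<zeta> \<ge> k / 2"
  let ?S = "attack_stream k T []" and ?G = "attack_accurate k T \<zeta> []"
  have str: "?S X \<in> restricted_streams n T" for X
    using k by (intro attack_stream_restricted) auto
  then have str': "?S X \<in> streams_of n T" for X
    by (auto simp: restricted_streams_def)
  have G: "?G X \<in> sets (output_space T)" for X
    using k by (intro attack_accurate_sets) auto
  have meas: "measure (A (?S X)) (?G X) \<ge> 99 / 100" if "X \<subseteq> {..<k}" for X
    using that k by (intro measure_attack_accurate[OF rel acc str]) auto
  have "99 / 100 \<le> measure (A (?S (sym_diff {} {..<k}))) (?G {..<k})"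
    using meas[of "{..<k}"] by simp
  also have "\<dots> \<le> exp (\<epsilon> * card {..<k}) * measure (A (?S {})) (?G {..<k})"
    using attack_stream_group_privacy[OF dp str' G, of "{..<k}"] by blast
  also have "\<dots> \<le> 3 * measure (A (?S {})) (?G {..<k})"
  proof (rule mult_right_mono)
    have "exp (\<epsilon> * card {..<k}) \<le> exp 1"
      using k by simp
    then show "exp (\<epsilon> * card {..<k}) \<le> 3"
      using exp_le by linarith
  qed simp
  finally have "measure (A (?S {})) (?G {..<k}) \<ge> 33 / 100"
    by simp
  moreover have "measure (A (?S {})) (?G {}) \<ge> 99 / 100"
    by (rule meas) simp
  moreover have "?G {} \<inter> ?G {..<k} = {}"
    using \<open>\<not> \<zeta> \<ge> k / 2\<close> by (auto simp: attack_accurate_def)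
  moreover interpret prob_space "A (?S {})"
    using rel str' by (auto simp: continual_release_def)
  have "sets (A (?S {})) = sets (output_space T)"
    using rel str' by (auto simp: continual_release_def)
  ultimately show False
    using finite_measure_Union[of "?G {}" "?G {..<k}"] G prob_le_1[of "?G {} \<union> ?G {..<k}"] by simp
qed

section \<open>Reconstruction with copied bits\<close>

text \<open>For \<open>B \<ge> 1\<close>, bit \<open>i\<close> owns the \<open>B\<close> gadgets
  from \<open>i * B\<close> on. Answers scale by \<open>B\<close>, while flipping a bit still costs
  only \<open>exp (\<epsilon> * B)\<close>.\<close>

definition blocks :: "nat \<Rightarrow> nat set \<Rightarrow> nat set" where
  "blocks B Y = {k. k div B \<in> Y}"

lemma blocks_subset: "1 \<le> B \<Longrightarrow> Y \<subseteq> {..<m} \<Longrightarrow> blocks B Y \<subseteq> {..<m * B}"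
  by (auto simp: blocks_def div_less_iff_less_mult[symmetric])

lemma card_blocks:
  assumes "1 \<le> B"
  shows "card (blocks B Y) = card Y * B"
proof -
  have "bij_betw (\<lambda>(i, r). i * B + r) (Y \<times> {..<B}) (blocks B Y)"
    using assms by (intro bij_betw_byWitness[where f' = "\<lambda>k. (k div B, k mod B)"])
      (auto simp: blocks_def)
  from bij_betw_same_card[OF this] show ?thesis
    by (simp add: card_cartesian_product)
qed

text \<open>The constant \<open>20\<close> comes from the decoder:
  \<open>(\<zeta> / B)\<^sup>2 \<le> m / 400\<close> gives total squared error at most
  \<open>9 * m / 400\<close>. A wrong bit contributes at least \<open>1 / 4\<close>, so at most
  \<open>36 * m / 400 \<le> m / 10\<close> bits are wrong.\<close>

lemma reconstruction_error_bound:
  fixes m B :: nat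
  assumes rel: "continual_release n T A" and dp: "edge_DP n T \<epsilon> A"
    and acc: "matching_accurate_on (restricted_streams n T) T \<zeta> A"
    and m: "m = 2 ^ r" and B: "1 \<le> B" "\<epsilon> * real B \<le> 1"
    and n: "3 * (m * B) \<le> n" and T: "m * B * Suc m \<le> T"
  shows "\<zeta> \<ge> B * sqrt m / 20"
proof (rule ccontr)
  assume small: "\<not> \<zeta> \<ge> B * sqrt m / 20"
  have m1: "1 \<le> m" and rm: "real m = 2 ^ r"
    by (simp_all add: m)
  obtain h :: "nat \<Rightarrow> nat \<Rightarrow> real" where h: "\<And>j i. h j i = 1 \<or> h j i = - 1" "\<And>i. h 0 i = 1"
    "\<And>j i. h j i = h i j"
    "\<And>i k. i < m \<Longrightarrow> k < m \<Longrightarrow> (\<Sum>j<m. h j i * h j k) = (if i = k then real m else 0)"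
    using hadamard_matrix_exists[of r] unfolding m[symmetric] rm[symmetric] by blast
  define N where "N = m * B"
  define Qs where "Qs = map (\<lambda>j. blocks B (negative_columns m h j)) [0..<m]"
  have len: "length Qs = m"
    by (simp add: Qs_def)
  have N: "1 \<le> N" "N * Suc (length Qs) \<le> T"
    using m1 B T by (auto simp: N_def len)
  have Qs: "Q \<subseteq> {..<N}" if "Q \<in> set Qs" for Q
  proof -
    have "negative_columns m h j \<subseteq> {..<m}" for j
      by (auto simp: negative_columns_def)
    from blocks_subset[OF B(1) this] show ?thesis
      using that by (auto simp: Qs_def N_def)
  qed
  define S where "S Y = attack_stream N T Qs (blocks B Y)" for Y
  define G where "G Y = attack_accurate N T \<zeta> Qs (blocks B Y)" for Y
  \<comment> \<open>Row \<open>j\<close> is asked in phase \<open>Suc j\<close>, which ends after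
    \<open>N * Suc (Suc j)\<close> updates; division by \<open>B\<close> converts gadgets to
    bits.\<close>
  define u :: "(nat \<Rightarrow> real) \<Rightarrow> nat \<Rightarrow> real" where "u w j = w (N * Suc (Suc j) - 1) / B" for w j
  define dec where "dec i = {w \<in> space (output_space T). 1 / 2 < hadamard_decode m h (u w) i}" for i
  have str: "attack_stream N T Qs X \<in> restricted_streams n T" for X
    using n[folded N_def] N by (intro attack_stream_restricted) linarith+
  then have str': "attack_stream N T Qs X \<in> streams_of n T" for X
    by (auto simp: restricted_streams_def)
  have u_meas: "(\<lambda>w. u w j) \<in> borel_measurable (output_space T)" if "j < m" for j
    unfolding u_def using that
    by (intro borel_measurable_divide borel_measurable_const output_coordinate_measurable
        attack_time_less[OF N]) (simp add: len)
  show False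
  proof (rule no_private_reconstruction[where \<mu> = "\<lambda>Y. A (S Y)" and M = "output_space T"
        and dec = dec and G = G and m = m])
    show "1 \<le> m" by fact
  next
    fix Y :: "nat set"
    show "prob_space (A (S Y))" "sets (A (S Y)) = sets (output_space T)"
      using rel str' by (auto simp: continual_release_def S_def)
  next
    fix i
    have "(\<lambda>w. hadamard_decode m h (u w) i) \<in> borel_measurable (output_space T)"
      unfolding hadamard_decode_def using m1
      by (intro borel_measurable_divide borel_measurable_const borel_measurable_sum
          borel_measurable_times borel_measurable_diff u_meas) auto
    then show "dec i \<in> sets (output_space T)"
      unfolding dec_def by measurable
  next
    fix Y assume "Y \<subseteq> {..<m}"
    then show "G Y \<in> sets (output_space T) \<and> measure (A (S Y)) (G Y) \<ge> 99 / 100"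
      unfolding G_def S_def
      using attack_accurate_sets[OF N] measure_attack_accurate[OF rel acc str N _ Qs]
        blocks_subset[OF B(1)] by (simp add: N_def)
  next
    fix Y w assume Y: "Y \<subseteq> {..<m}" and w: "w \<in> G Y"
    have "\<bar>u w j - card (Y \<union> negative_columns m h j)\<bar> \<le> \<zeta> / B" if "j < m" for j
    proof -
      have "blocks B Y \<union> Qs ! j = blocks B (Y \<union> negative_columns m h j)"
        using that by (auto simp: Qs_def blocks_def)
      then have "\<bar>w (N * Suc (Suc j) - 1) - card (Y \<union> negative_columns m h j) * B\<bar> \<le> \<zeta>"
        using w that B len unfolding G_def attack_accurate_def
        by (auto simp: card_blocks dest!: bspec[where x = "Suc j"])
      then have "\<bar>w (N * Suc (Suc j) - 1) - card (Y \<union> negative_columns m h j) * B\<bar> / B \<le> \<zeta> / B"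
        by (intro divide_right_mono) auto
      also have "\<bar>w (N * Suc (Suc j) - 1) - card (Y \<union> negative_columns m h j) * B\<bar> / B =
          \<bar>(w (N * Suc (Suc j) - 1) - card (Y \<union> negative_columns m h j) * B) / B\<bar>"
        by (simp add: abs_divide)
      finally show ?thesis
        using B unfolding u_def by (simp add: diff_divide_distrib)
    qed
    note close = this
    \<comment> \<open>Squaring the bound needs this sign, which the existence of an accurate output
      provides.\<close>
    have "0 \<le> \<zeta> / B"
      using close[of 0] m1 by linarith
    moreover have "\<zeta> / B \<le> sqrt m / 20"
      using small B by (simp add: field_simps)
    ultimately have "(\<zeta> / B)\<^sup>2 \<le> (sqrt m / 20)\<^sup>2"
      by (intro power_mono)
    then have sq: "(\<zeta> / B)\<^sup>2 \<le> m / 400"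
      by (simp add: power_divide)
    let ?I = "{i \<in> {..<m}. (w \<in> dec i) \<noteq> (i \<in> Y)}"
    have "card ?I * (1 / 4) = (\<Sum>i\<in>?I. (1 / 2)\<^sup>2 :: real)"
      by (simp add: power_divide)
    also have "\<dots> \<le> (\<Sum>i\<in>?I. (hadamard_decode m h (u w) i - of_bool (i \<in> Y))\<^sup>2)"
    proof (rule sum_mono)
      fix i assume i: "i \<in> ?I"
      have "w \<in> space (output_space T)"
        using w by (simp add: G_def attack_accurate_def)
      then have "1 / 2 \<le> \<bar>hadamard_decode m h (u w) i - of_bool (i \<in> Y)\<bar>"
        using i by (auto simp: dec_def of_bool_def)
      then have "(1 / 2)\<^sup>2 \<le> \<bar>hadamard_decode m h (u w) i - of_bool (i \<in> Y)\<bar>\<^sup>2"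
        by (intro power_mono) auto
      then show "(1 / 2)\<^sup>2 \<le> (hadamard_decode m h (u w) i - of_bool (i \<in> Y))\<^sup>2"
        by simp
    qed
    also have "\<dots> \<le> (\<Sum>i<m. (hadamard_decode m h (u w) i - of_bool (i \<in> Y))\<^sup>2)"
      by (intro sum_mono2) auto
    also have "\<dots> \<le> 9 * (\<zeta> / B)\<^sup>2"
      by (rule hadamard_decode_error[OF h m1 Y close])
    finally show "card ?I \<le> m / 10"
      using sq by linarith
  next
    fix Y i E assume i: "i < m" and E: "E \<in> sets (output_space T)"
    let ?X = "blocks B (sym_diff Y {i})"
    have "sym_diff ?X (blocks B {i}) = blocks B Y"
      by (auto simp: blocks_def)
    moreover have "blocks B {i} \<subseteq> {..<N}"
      using blocks_subset[OF B(1), of "{i}" m] i by (simp add: N_def)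
    ultimately have "measure (A (S Y)) E \<le>
        exp (\<epsilon> * card (blocks B {i})) * measure (A (S (sym_diff Y {i}))) E"
      unfolding S_def using attack_stream_group_privacy[OF dp str' E, of "blocks B {i}" ?X] by simp
    also have "\<dots> \<le> exp 1 * measure (A (S (sym_diff Y {i}))) E"
      using B by (intro mult_right_mono) (auto simp: card_blocks)
    finally show "measure (A (S Y)) E \<le> exp 1 * measure (A (S (sym_diff Y {i}))) E" .
  qed
qed

section \<open>Choice of parameters\<close>

lemma error_bound_le_if_data_limited:
  assumes n: "2 \<le> n" and small: "n < 3 * B \<or> T < 2 * B"
  shows "1 / 80 * error_bound n T \<epsilon> \<le> real (min B (min (n div 2) T)) / 2"
proof -
  have "error_bound n T \<epsilon> \<le> real n" "error_bound n T \<epsilon> \<le> real T"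
    by (auto simp: error_bound_def)
  \<comment> \<open>Rounding down is worst at \<open>n = 3\<close>. So the minimum of
    \<open>B\<close>, \<open>n div 2\<close> and \<open>T\<close> is at least a third of
    \<open>min n T\<close> in both cases.\<close>
  moreover have "n \<le> 3 * (n div 2)"
    using n by presburger
  then have "real n \<le> 3 * real (n div 2)"
    by linarith
  ultimately show ?thesis
    using small by (auto simp: min_def)
qed

text \<open>The Hadamard matrices at hand have orders \<open>2 ^ r\<close>; taking the largest
  admissible one means that doubling it already violates a constraint.\<close>

lemma largest_power_of_two:
  fixes P :: "nat \<Rightarrow> bool"
  assumes "P 1" "\<And>r. P (2 ^ r) \<Longrightarrow> r < K"
  obtains r where "P (2 ^ r)" "\<not> P (2 * 2 ^ r)"
proof -
  have "\<exists>r. P (2 ^ r) \<and> (\<forall>s. P (2 ^ s) \<longrightarrow> s \<le> r)"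
    using Nat.ex_has_greatest_nat[of "\<lambda>r. P (2 ^ r)" 0 K] assms by (force simp: less_imp_le)
  then obtain r where "P (2 ^ r)" "\<And>s. P (2 ^ s) \<Longrightarrow> s \<le> r"
    by blast
  then show thesis
    using that[of r] by (metis Suc_n_not_le_n power_Suc)
qed

text \<open>If \<open>2 * m\<close> is inadmissible, then \<open>n < 6 * m * B\<close> or
  \<open>T \<le> 6 * m^2 * B\<close>. Together with \<open>1 / \<epsilon> \<le> 2 * B\<close> this
  bounds \<open>n / \<epsilon>\<close> by \<open>12 * m * B^2\<close> or
  \<open>T / \<epsilon>^3\<close> by \<open>48 * m^2 * B^4\<close>; the constants are rounded up to
  \<open>4^2\<close> and \<open>4^4\<close>.\<close>

lemma error_bound_le_if_reconstruction_limited: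
  fixes m B :: nat
  assumes \<epsilon>: "0 < \<epsilon>" and B: "1 / \<epsilon> \<le> 2 * real B" and m: "1 \<le> m"
    and large: "n < 3 * (2 * m * B) \<or> T < 2 * m * B * Suc (2 * m)"
  shows "error_bound n T \<epsilon> \<le> 4 * (B * sqrt m)"
  using large
proof
  assume n: "n < 3 * (2 * m * B)"
  then have "real n \<le> real (3 * (2 * m * B))"
    by linarith
  then have n6: "real n \<le> 6 * (real m * real B)"
    by simp
  have "real n / \<epsilon> = real n * (1 / \<epsilon>)"
    by simp
  also have "\<dots> \<le> (6 * (real m * real B)) * (2 * real B)"
    using n6 B \<epsilon> by (intro mult_mono) auto
  also have "\<dots> = 12 * ((real B)\<^sup>2 * real m)"
    by (simp add: power2_eq_square)
  also have "\<dots> \<le> 16 * ((real B)\<^sup>2 * real m)"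
    by (intro mult_right_mono) auto
  also have "\<dots> = (4 * (B * sqrt m))\<^sup>2"
    by (simp add: power_mult_distrib)
  finally have "sqrt (real n / \<epsilon>) \<le> 4 * (B * sqrt m)"
    by (intro real_le_lsqrt) auto
  then show ?thesis
    by (simp add: error_bound_def)
next
  assume T: "T < 2 * m * B * Suc (2 * m)"
  also have "\<dots> \<le> 2 * m * B * (3 * m)"
    using m by (intro mult_left_mono) auto
  finally have "real T \<le> real (2 * m * B * (3 * m))"
    by linarith
  then have T6: "real T \<le> 6 * (real m)\<^sup>2 * real B"
    by (simp add: power2_eq_square mult_ac)
  let ?x = "real T powr (1 / 4) / \<epsilon> powr (3 / 4)"
  have "(\<epsilon> powr (3 / 4)) ^ 4 = \<epsilon> ^ 3"
    using \<epsilon> powr_realpow[of \<epsilon> 3] by (auto simp: powr_power)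
  moreover have "(real T powr (1 / 4)) ^ 4 = real T"
    by (cases "T = 0") (auto simp: powr_power)
  ultimately have "?x ^ 4 = real T * (1 / \<epsilon>) ^ 3"
    by (simp add: power_divide)
  also have "\<dots> \<le> (6 * (real m)\<^sup>2 * real B) * (2 * real B) ^ 3"
    using T6 B \<epsilon> by (intro mult_mono power_mono) auto
  also have "\<dots> = 48 * (real B ^ 4 * (real m)\<^sup>2)"
    by (simp add: power_mult_distrib eval_nat_numeral)
  also have "\<dots> \<le> 256 * (real B ^ 4 * (real m)\<^sup>2)"
    by (intro mult_right_mono) auto
  also have "\<dots> = (4 * (B * sqrt m)) ^ 4"
    using power_mult[of "sqrt m" 2 2] by (simp add: power_mult_distrib)
  finally have "?x ^ Suc 3 \<le> (4 * (B * sqrt m)) ^ Suc 3"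
    by simp
  then have "?x \<le> 4 * (B * sqrt m)"
    by (rule power_le_imp_le_base) simp
  then show ?thesis
    by (simp add: error_bound_def)
qed

lemma restricted_error_bound:
  assumes \<epsilon>: "0 < \<epsilon>" "\<epsilon> < 1" and nT: "2 \<le> n" "1 \<le> T"
    and rel: "continual_release n T A" and dp: "edge_DP n T \<epsilon> A"
    and acc: "matching_accurate_on (restricted_streams n T) T \<zeta> A"
  shows "\<zeta> \<ge> 1 / 80 * error_bound n T \<epsilon>"
proof -
  \<comment> \<open>The largest number of copies with \<open>\<epsilon> * B \<le> 1\<close>; since
    \<open>\<epsilon> < 1\<close>, it is at least \<open>1\<close> and rounding loses at most a
    factor of two.\<close>
  define B where "B = nat \<lfloor>1 / \<epsilon>\<rfloor>"
  have "1 < 1 / \<epsilon>"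
    using \<epsilon> by simp
  then have "1 \<le> B" "real B \<le> 1 / \<epsilon>" "1 / \<epsilon> < real B + 1"
    unfolding B_def by linarith+
  then have B: "1 \<le> B" "real B \<le> 1 / \<epsilon>" "1 / \<epsilon> \<le> 2 * real B"
    by simp_all
  have \<epsilon>B: "\<epsilon> * real B \<le> 1"
    using B(2) \<epsilon> by (simp add: field_simps)
  show ?thesis
  \<comment> \<open>The case distinction asks whether even \<open>m = 1\<close> is inadmissible for
    the reconstruction attack.\<close>
  proof (cases "n < 3 * B \<or> T < 2 * B")
    case True
    define k where "k = min B (min (n div 2) T)"
    have "\<epsilon> * real k \<le> \<epsilon> * real B"
      using \<epsilon> by (intro mult_left_mono) (auto simp: k_def)
    then have "\<zeta> \<ge> k / 2"
      using B nT \<epsilon>B by (intro two_point_error_bound[OF rel dp acc]) (auto simp: k_def)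
    then show ?thesis
      using error_bound_le_if_data_limited[OF nT(1) True, of \<epsilon>] by (simp add: k_def)
  next
    case False
    define P where "P m \<longleftrightarrow> 3 * (m * B) \<le> n \<and> m * B * Suc m \<le> T" for m
    have "P 1"
      using False by (auto simp: P_def)
    moreover have "r < n" if "P (2 ^ r)" for r
    proof -
      have "2 ^ r * 1 \<le> 2 ^ r * B"
        using B by (intro mult_left_mono) auto
      then have "2 ^ r \<le> n"
        using that unfolding P_def by linarith
      then show ?thesis
        using less_exp[of r] by linarith
    qed
    ultimately obtain r where r: "P (2 ^ r)" "\<not> P (2 * 2 ^ r)"
      by (rule largest_power_of_two)
    \<comment> \<open>The factors \<open>1 / 20\<close> here and \<open>4\<close> below multiply to
      the constant \<open>1 / 80\<close>.\<close>
    have "\<zeta> \<ge> B * sqrt ((2 ^ r :: nat)) / 20"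
      using r(1) by (intro reconstruction_error_bound[OF rel dp acc refl B(1) \<epsilon>B]) (auto simp: P_def)
    moreover have "error_bound n T \<epsilon> \<le> 4 * (B * sqrt ((2 ^ r :: nat)))"
      using r(2) by (intro error_bound_le_if_reconstruction_limited[OF \<epsilon>(1) B(3)])
        (auto simp: P_def not_le simp del: mult_Suc_right)
    ultimately show ?thesis
      by linarith
  qed
qed

theorem theorem8p5:
  shows "\<exists>c>0. \<forall>(\<epsilon>::real) (n::nat) (T::nat) (A::mechanism) (\<zeta>::real).
    0 < \<epsilon> \<longrightarrow> \<epsilon> < 1 \<longrightarrow> 2 \<le> n \<longrightarrow> 1 \<le> T \<longrightarrow>
    continual_release n T A \<longrightarrow> edge_DP n T \<epsilon> A \<longrightarrow>
      (matching_accurate_on (streams_of n T) T \<zeta> A \<longrightarrow> \<zeta> \<ge> c * error_bound n T \<epsilon>) \<and>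
      (matching_accurate_on (restricted_streams n T) T \<zeta> A \<longrightarrow> \<zeta> \<ge> c * error_bound n T \<epsilon>)"
proof -
  \<comment> \<open>Accuracy on fewer streams is the weaker demand, so the restricted bound yields
    both claims.\<close>
  have "matching_accurate_on (restricted_streams n T) T \<zeta> A"
    if "matching_accurate_on (streams_of n T) T \<zeta> A" for n T \<zeta> A
    using that by (auto simp: matching_accurate_on_def restricted_streams_def)
  then show ?thesis
    using restricted_error_bound by (intro exI[of _ "1 / 80"]) auto
qed

end
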